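(* Let $D$ be a digraph of order $n$ and let $1\le k\le n-1$. The digraph $F_k(D)$ is strongly connected if and only if $D$ is strongly connected.
   Context: A digraph $D$ has a finite vertex set $V(D)$ and a set $A(D)$ of arcs, which are ordered pairs of distinct vertices (both $(x,y)$ and $(y,x)$ may be arcs). For a digraph $D$ of order $n$ and $1 \le k \le n-1$, the $k$-token digraph $F_k(D)$ has as vertices all $k$-subsets of $V(D)$, and $(A,B)$ is an arc of $F_k(D)$ whenever $A\setminus B=\{a\}$, $B\setminus A=\{b\}$ and $(a,b)\in A(D)$. A digraph is strongly connected if for every two vertices $x,y$ there are a directed path from $x$ to $y$ and a directed path from $y$ to $x$. *)

theory Defs
  imports "Graph_Theory.Graph_Theory"
begin

definition token_digraph :: "nat \<Rightarrow> 'a pair_pre_digraph \<Rightarrow> 'a set pair_pre_digraph" where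
  "token_digraph k D = \<lparr>
     pverts = {A. A \<subseteq> pverts D \<and> card A = k},
     parcs = {(A, B). A \<subseteq> pverts D \<and> card A = k \<and> B \<subseteq> pverts D \<and> card B = k \<and>
       (\<exists>a b. A - B = {a} \<and> B - A = {b} \<and> (a, b) \<in> parcs D)} \<rparr>"

lemma pair_digraph_token_digraph:
  assumes "pair_digraph D"
  shows "pair_digraph (token_digraph k D)"
proof -
  interpret pair_digraph D by fact
  let ?F = "token_digraph k D"
  have v: "finite (pverts ?F)"
    by (rule finite_subset[of _ "Pow (pverts D)"]) (auto simp: token_digraph_def)
  have sub: "parcs ?F \<subseteq> pverts ?F \<times> pverts ?F"
    by (auto simp: token_digraph_def)
  show ?thesis
  proof
    show "finite (parcs ?F)"
      by (rule finite_subset[OF sub]) (simp add: v)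
    show "finite (pverts ?F)" by (rule v)
  next
    fix e assume e: "e \<in> parcs ?F"
    from e sub have "e \<in> pverts ?F \<times> pverts ?F" by (rule rev_subsetD)
    then show "fst e \<in> pverts ?F" "snd e \<in> pverts ?F"
      by (simp_all add: mem_Times_iff)
    from e obtain a where "fst e - snd e = {a}"
      by (cases e) (simp add: token_digraph_def, blast)
    then show "fst e \<noteq> snd e"
      by (metis Diff_cancel insert_not_empty)
  qed
qed

end

theory Submission
  imports Defs
begin

text \<open>
  Picture a vertex of the token digraph as \<open>k\<close> indistinguishable tokens on distinct vertices of \<open>D\<close>;
  an arc slides one token along an arc of \<open>D\<close> to a free vertex.

  If \<open>D\<close> is strongly connected, a token can be transported from an occupied vertex \<open>a\<close> to any free
  vertex \<open>b\<close> with the net effect that only \<open>a\<close> and \<open>b\<close> change status (\<open>token_transport\<close>): a token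
  in the way on a path from \<open>a\<close> to \<open>b\<close> is itself sent on to \<open>b\<close>, and the one behind it takes its
  place. Repeating this turns any configuration into any other.

  If \<open>D\<close> is not strongly connected, some \<open>v\<close> is unreachable from some \<open>u\<close>. No arc leaves the set \<open>R\<close>
  of vertices reachable from \<open>u\<close>, so the number of tokens on \<open>R\<close> never decreases
  (\<open>tokens_in_closed_set_mono\<close>). As \<open>1 \<le> k \<le> n - 1\<close>, there is a configuration that occupies \<open>u\<close>
  and leaves \<open>v\<close> free; moving its token on \<open>u\<close> to \<open>v\<close> gives a configuration with fewer tokens on
  \<open>R\<close>, hence an unreachable one.
\<close>

context pair_digraph
begin

lemma finite_token_vertex:
  "A \<in> pverts (token_digraph k G) \<Longrightarrow> finite A"
  by (auto simp: token_digraph_def intro: finite_subset)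

lemma token_vertex_exchange:
  assumes "A \<in> pverts (token_digraph k G)" "a \<in> A" "b \<notin> A" "b \<in> pverts G"
  shows "insert b (A - {a}) \<in> pverts (token_digraph k G)"
  using assms finite_token_vertex[OF assms(1)] card_Suc_Diff1[of A a]
  by (auto simp: token_digraph_def)

lemma token_slide:
  assumes "A \<in> pverts (token_digraph k G)" "a \<in> A" "b \<notin> A" "(a, b) \<in> parcs G"
  shows "(A, insert b (A - {a})) \<in> parcs (token_digraph k G)"
proof -
  have "b \<in> pverts G"
    using assms(4) by (auto dest: in_arcsD2)
  then have "insert b (A - {a}) \<in> pverts (token_digraph k G)"
    by (rule token_vertex_exchange[OF assms(1-3)])
  moreover have "A - insert b (A - {a}) = {a}" "insert b (A - {a}) - A = {b}"
    using assms(2,3) by auto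
  ultimately show ?thesis
    using assms(1,4) by (auto simp: token_digraph_def)
qed

text \<open>
  Induction along the walk from \<open>a\<close> to \<open>b\<close>, for all configurations at once. If the second vertex
  \<open>c\<close> of the walk is free, the token slides there and continues. If \<open>c\<close> is occupied, the order is
  reversed: first the token on \<open>c\<close> goes to \<open>b\<close>, and then the token on \<open>a\<close> slides to the vacated \<open>c\<close>.
  Tokens being indistinguishable, both give the same configuration.
\<close>

lemma token_transport:
  assumes "reachable (with_proj G) a b"
    and "A \<in> pverts (token_digraph k G)" "a \<in> A" "b \<notin> A"
  shows "reachable (with_proj (token_digraph k G)) A (insert b (A - {a}))"
  using assms
proof (induction a arbitrary: A)
  case base
  then show ?case by simp
next
  case (step a c)
  interpret F: pair_digraph "token_digraph k G"
    by (rule pair_digraph_token_digraph) unfold_locales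
  have ac: "(a, c) \<in> parcs G"
    using step.hyps(1) by simp
  have b: "b \<in> pverts G"
    using step.hyps(2) reachable_in_verts(2) by fastforce
  have "a \<noteq> c"
    using ac no_loops by fastforce
  show ?case
  proof (cases "c \<in> A")
    case False
    let ?B = "insert c (A - {a})"
    have slide: "(A, ?B) \<in> parcs (token_digraph k G)"
      using step.prems(1,2) False ac by (rule token_slide)
    then have B: "?B \<in> pverts (token_digraph k G)"
      by (rule F.in_arcsD2)
    show ?thesis
    proof (cases "b = c")
      case True
      then show ?thesis
        using F.reachable_adjI[of A ?B] slide by simp
    next
      case neq: False
      have "reachable (with_proj (token_digraph k G)) ?B (insert b (?B - {c}))"
        using B by (rule step.IH) (use step.prems(3) neq in auto)
      moreover have "insert b (?B - {c}) = insert b (A - {a})"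
        using False by auto
      ultimately show ?thesis
        using F.adj_reachable_trans[of A ?B] slide by simp
    qed
  next
    case True
    let ?B = "insert b (A - {c})"
    have "reachable (with_proj (token_digraph k G)) A ?B"
      using step.prems(1) True step.prems(3) by (rule step.IH)
    moreover have "(?B, insert c (?B - {a})) \<in> parcs (token_digraph k G)"
    proof (rule token_slide)
      show "?B \<in> pverts (token_digraph k G)"
        using step.prems(1) True step.prems(3) b by (rule token_vertex_exchange)
    qed (use step.prems True ac \<open>a \<noteq> c\<close> in auto)
    moreover have "insert c (?B - {a}) = insert b (A - {a})"
      using step.prems True \<open>a \<noteq> c\<close> by auto
    ultimately show ?thesis
      using F.reachable_adj_trans[of A ?B] by simp
  qed
qed

text \<open>
  Two distinct sets of the same size \<open>k\<close> each contain a vertex missing from the other, so one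
  transport brings \<open>A\<close> one step closer to \<open>B\<close>.
\<close>

lemma token_digraph_reachable:
  assumes conn: "\<And>u v. u \<in> pverts G \<Longrightarrow> v \<in> pverts G \<Longrightarrow> reachable (with_proj G) u v"
    and "A \<in> pverts (token_digraph k G)" and B: "B \<in> pverts (token_digraph k G)"
  shows "reachable (with_proj (token_digraph k G)) A B"
  using assms(2)
proof (induction "card (A - B)" arbitrary: A rule: less_induct)
  case less
  interpret F: pair_digraph "token_digraph k G"
    by (rule pair_digraph_token_digraph) unfold_locales
  have fin: "finite A" "finite B"
    using less.prems[THEN finite_token_vertex] B[THEN finite_token_vertex] .
  have eq: "card A = card B" and sub: "A \<subseteq> pverts G" "B \<subseteq> pverts G"
    using less.prems B by (simp_all add: token_digraph_def)
  show ?case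
  proof (cases "A = B")
    case True
    then show ?thesis using B by simp
  next
    case False
    then have "\<not> A \<subseteq> B" "\<not> B \<subseteq> A"
      using card_subset_eq[OF fin(2) _ eq] card_subset_eq[OF fin(1) _ eq[symmetric]] by blast+
    then obtain a b where ab: "a \<in> A" "a \<notin> B" "b \<in> B" "b \<notin> A"
      by blast
    let ?A' = "insert b (A - {a})"
    have "?A' - B = (A - B) - {a}"
      using ab(3) by auto
    then have "card (?A' - B) < card (A - B)"
      using ab(1,2) fin(1) card_Diff1_less[of "A - B" a] by simp
    moreover have "?A' \<in> pverts (token_digraph k G)"
      using less.prems ab(1,4) by (rule token_vertex_exchange) (use ab(3) sub in blast)
    ultimately have closer: "reachable (with_proj (token_digraph k G)) ?A' B"
      by (rule less.hyps)
    have "reachable (with_proj (token_digraph k G)) A ?A'"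
    proof (rule token_transport)
      show "reachable (with_proj G) a b"
        using ab(1,3) sub by (intro conn) blast+
    qed (use less.prems ab in auto)
    then show ?thesis
      using closer by (rule F.reachable_trans)
  qed
qed

text \<open>
  A slide out of \<open>a\<close> removes a token from \<open>R\<close> only if \<open>a \<in> R\<close>, and then closedness makes the
  token land in \<open>R\<close> again.
\<close>

lemma tokens_in_closed_set_mono:
  assumes closed: "\<And>x y. x \<in> R \<Longrightarrow> (x, y) \<in> parcs G \<Longrightarrow> y \<in> R"
    and "reachable (with_proj (token_digraph k G)) A B"
  shows "card (A \<inter> R) \<le> card (B \<inter> R)"
proof -
  interpret F: pair_digraph "token_digraph k G"
    by (rule pair_digraph_token_digraph) unfold_locales
  show ?thesis
    using assms(2)
  proof (induction rule: F.reachable_induct)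
    case base
    then show ?case by simp
  next
    case (step X Y)
    have fin: "finite X" "finite Y"
      using F.adj_in_verts[OF step.hyps(2)] finite_token_vertex by simp_all
    from step.hyps(2) obtain a b
      where ab: "X - Y = {a}" "Y - X = {b}" "(a, b) \<in> parcs G"
      by (auto simp: token_digraph_def)
    have "card (X \<inter> R) \<le> card (Y \<inter> R)"
    proof (cases "a \<in> R")
      case True
      then have "b \<in> R"
        using closed ab(3) by blast
      then have "Y \<inter> R = insert b (X \<inter> R - {a})"
        using ab(1,2) by blast
      moreover have "b \<notin> X" "a \<in> X \<inter> R"
        using ab(1,2) True by auto
      ultimately have "card (Y \<inter> R) = card (X \<inter> R)"
        using fin card_Suc_Diff1[of "X \<inter> R" a] by simp
      then show ?thesis by simp
    next
      case False
      then have "X \<inter> R \<subseteq> Y \<inter> R"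
        using ab(1) by auto
      then show ?thesis
        using fin by (intro card_mono) auto
    qed
    with step.IH show ?case by simp
  qed
qed

lemma reachable_if_token_digraph_reachable:
  assumes conn: "\<And>A B. A \<in> pverts (token_digraph k G) \<Longrightarrow> B \<in> pverts (token_digraph k G)
      \<Longrightarrow> reachable (with_proj (token_digraph k G)) A B"
    and k: "1 \<le> k" "k \<le> card (pverts G) - 1"
    and uv: "u \<in> pverts G" "v \<in> pverts G"
  shows "reachable (with_proj G) u v"
proof (rule ccontr)
  assume unreachable: "\<not> reachable (with_proj G) u v"
  define R where "R = {x. reachable (with_proj G) u x}"
  have closed: "y \<in> R" if "x \<in> R" "(x, y) \<in> parcs G" for x y
    using that reachable_adj_trans[of u x y] unfolding R_def by simp
  have R: "u \<in> R" "v \<notin> R"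
    using uv unreachable by (auto simp: R_def)
  \<comment> \<open>\<open>C\<close> holds the tokens common to the two configurations, which differ only in whether the
      last token sits on \<open>u\<close> or on \<open>v\<close>; it avoids both, hence the bound \<open>n - 2\<close> on its size.\<close>
  have "u \<noteq> v"
    using R by blast
  then have "k - 1 \<le> card (pverts G - {u, v})"
    using uv k by (simp add: card_Diff_subset)
  then obtain C where C: "C \<subseteq> pverts G - {u, v}" "card C = k - 1" "finite C"
    by (rule obtain_subset_with_card_n)
  have "insert u C \<in> pverts (token_digraph k G)" "insert v C \<in> pverts (token_digraph k G)"
    using C k uv by (auto simp: token_digraph_def card_insert_if)
  then have "reachable (with_proj (token_digraph k G)) (insert u C) (insert v C)"
    by (rule conn)
  with closed have "card (insert u C \<inter> R) \<le> card (insert v C \<inter> R)"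
    by (rule tokens_in_closed_set_mono)
  moreover have "insert u C \<inter> R = insert u (C \<inter> R)" "insert v C \<inter> R = C \<inter> R" "u \<notin> C \<inter> R"
    using C(1) R by auto
  ultimately show False
    using C(3) by simp
qed

end

theorem corollary3p1:
  fixes D :: "'a pair_pre_digraph" and n k :: nat
  assumes "pair_digraph D"
    and "card (pverts D) = n"
    and "1 \<le> k" and "k \<le> n - 1"
  shows "strongly_connected (with_proj (token_digraph k D)) \<longleftrightarrow> strongly_connected (with_proj D)"
proof -
  interpret pair_digraph D by fact
  have "pverts D \<noteq> {}"
    using assms(2-4) by auto
  moreover have "pverts (token_digraph k D) \<noteq> {}"
  proof -
    have "k \<le> card (pverts D)"
      using assms(2,4) by simp
    then obtain A where "A \<subseteq> pverts D" "card A = k"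
      by (rule obtain_subset_with_card_n)
    then show ?thesis
      by (auto simp: token_digraph_def)
  qed
  moreover have "(\<forall>A \<in> pverts (token_digraph k D). \<forall>B \<in> pverts (token_digraph k D).
        reachable (with_proj (token_digraph k D)) A B)
      \<longleftrightarrow> (\<forall>u \<in> pverts D. \<forall>v \<in> pverts D. reachable (with_proj D) u v)" (is "?F \<longleftrightarrow> ?D")
  proof
    assume ?F
    then show ?D
      using reachable_if_token_digraph_reachable[of k] assms(2-4) by blast
  next
    assume ?D
    then show ?F
      using token_digraph_reachable[of _ k] by blast
  qed
  ultimately show ?thesis
    by (simp add: strongly_connected_def)
qed

end
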